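(* Let $C$ be a clique cutset in a graph $G$, let $(A,B,C)$ be a cut-partition of $G$, and let $G_A=G[A\cup C]$ and $G_B=G[B\cup C]$. Then $\mathsf{tree}\text{-}\alpha(G)=\max\{\mathsf{tree}\text{-}\alpha(G_A),\mathsf{tree}\text{-}\alpha(G_B)\}$.
   Context: All graphs are finite, simple, and undirected. A cut-partition in a graph $G$ is a triple $(A,B,C)$ of pairwise disjoint sets such that $A\cup B\cup C=V(G)$, $A\neq\emptyset$, $B\neq\emptyset$, and $G$ has no edges with one endpoint in $A$ and one in $B$. A clique cutset in $G$ is a clique $C$ (set of pairwise adjacent vertices) such that $G$ has a cut-partition $(A,B,C)$ for some $A$ and $B$. A tree decomposition of a graph $G$ is a pair $\mathcal{T}=(T,\{X_t\}_{t\in V(T)})$ where $T$ is a tree and each node $t$ is assigned a bag $X_t\subseteq V(G)$ such that every vertex of $G$ is in at least one bag, every edge of $G$ has both endpoints in some common bag, and for every $u\in V(G)$ the subgraph of $T$ induced by $\{t: u\in X_t\}$ is connected. The independence number of $\mathcal{T}$ is $\alpha(\mathcal{T})=\max_{t\in V(T)}\alpha(G[X_t])$, where $\alpha(H)$ is the maximum size of an independent set in $H$. The tree-independence number $\mathsf{tree}\text{-}\alpha(G)$ is the minimum of $\alpha(\mathcal{T})$ over all tree decompositions $\mathcal{T}$ of $G$. *)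

theory Defs
  imports "Graph_Theory.Graph_Theory"
begin

text \<open>
  Finite simple undirected graphs are symmetric loop-free digraphs without multiple arcs,
  i.e. instances of the locale \<open>graph\<close>; each edge is a pair of opposite arcs, and
  \<open>G \<restriction> S\<close> is the subgraph of \<open>G\<close> induced by \<open>S\<close>.
\<close>

definition clique :: "('a, 'b) pre_digraph \<Rightarrow> 'a set \<Rightarrow> bool" where
  "clique G C \<longleftrightarrow> C \<subseteq> verts G \<and> pairwise (\<lambda>u v. u \<rightarrow>\<^bsub>G\<^esub> v) C"

definition cut_partition ::
  "('a, 'b) pre_digraph \<Rightarrow> 'a set \<Rightarrow> 'a set \<Rightarrow> 'a set \<Rightarrow> bool" where
  "cut_partition G A B C \<longleftrightarrow>
     A \<inter> B = {} \<and> A \<inter> C = {} \<and> B \<inter> C = {} \<and> A \<union> B \<union> C = verts G \<and>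
     A \<noteq> {} \<and> B \<noteq> {} \<and> (\<forall>a\<in>A. \<forall>b\<in>B. \<not> a \<rightarrow>\<^bsub>G\<^esub> b \<and> \<not> b \<rightarrow>\<^bsub>G\<^esub> a)"

definition clique_cutset :: "('a, 'b) pre_digraph \<Rightarrow> 'a set \<Rightarrow> bool" where
  "clique_cutset G C \<longleftrightarrow> clique G C \<and> (\<exists>A B. cut_partition G A B C)"

definition indep_set :: "('a, 'b) pre_digraph \<Rightarrow> 'a set \<Rightarrow> bool" where
  "indep_set G S \<longleftrightarrow> S \<subseteq> verts G \<and> (\<forall>u\<in>S. \<forall>v\<in>S. \<not> u \<rightarrow>\<^bsub>G\<^esub> v)"

definition indep_number :: "('a, 'b) pre_digraph \<Rightarrow> nat" where
  "indep_number G = Max {card S | S. indep_set G S}"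

text \<open>
  The library's \<open>tree\<close> is not usable for symmetric digraphs, since an arc followed by its
  reverse is a \<open>cycle\<close> of length 2. The cycles of the underlying undirected graph are the
  cycles of length at least 3. A tree is nonempty, as \<open>connected\<close> includes nonemptiness.
\<close>

definition undirected_tree :: "('t, 'e) pre_digraph \<Rightarrow> bool" where
  "undirected_tree T \<longleftrightarrow>
     graph T \<and> connected T \<and> \<not> (\<exists>p. pre_digraph.cycle T p \<and> length p \<ge> 3)"

definition tree_decomposition ::
  "('a, 'b) pre_digraph \<Rightarrow> ('t, 'e) pre_digraph \<Rightarrow> ('t \<Rightarrow> 'a set) \<Rightarrow> bool" where
  "tree_decomposition G T X \<longleftrightarrow>
     undirected_tree T \<and>
     (\<forall>t\<in>verts T. X t \<subseteq> verts G) \<and>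
     (\<forall>u\<in>verts G. \<exists>t\<in>verts T. u \<in> X t) \<and>
     (\<forall>u v. u \<rightarrow>\<^bsub>G\<^esub> v \<longrightarrow> (\<exists>t\<in>verts T. u \<in> X t \<and> v \<in> X t)) \<and>
     (\<forall>u\<in>verts G. connected (T \<restriction> {t \<in> verts T. u \<in> X t}))"

definition decomp_indep_number ::
  "('a, 'b) pre_digraph \<Rightarrow> ('t, 'e) pre_digraph \<Rightarrow> ('t \<Rightarrow> 'a set) \<Rightarrow> nat" where
  "decomp_indep_number G T X = Max {indep_number (G \<restriction> X t) | t. t \<in> verts T}"

text \<open>
  Decomposition trees are finite, so it is no restriction to take natural numbers as nodes
  and pairs of nodes as arcs.
\<close>

definition tree_alpha :: "('a, 'b) pre_digraph \<Rightarrow> nat" where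
  "tree_alpha G =
     (LEAST k. \<exists>(T :: nat pair_pre_digraph) X.
        tree_decomposition G (with_proj T) X \<and> decomp_indep_number G (with_proj T) X = k)"

end

theory Submission
  imports Defs
begin

text \<open>
  Intersecting the bags of a tree decomposition with \<open>S\<close> decomposes the subgraph induced by
  \<open>S\<close>, hence \<open>tree_alpha\<close> does not increase under taking induced subgraphs. Conversely, the
  nodes whose bag contains a given vertex form a subtree, and the subtrees of the vertices of the
  clique \<open>C\<close> intersect pairwise; by the Helly property of subtrees some bag of each of the two
  given decompositions contains \<open>C\<close>. Joining two such bags by an edge yields a tree
  decomposition of \<open>G\<close> that has no new bags.
\<close>

section \<open>Trees as symmetric relations\<close>

text \<open>Walks have to stay inside \<open>S\<close>, so this is connectivity of the subgraph
  induced by \<open>S\<close>; nonemptiness is included to match \<open>connected\<close>.\<close>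

definition rel_connected :: "'t rel \<Rightarrow> 't set \<Rightarrow> bool" where
  "rel_connected E S \<longleftrightarrow> S \<noteq> {} \<and> (\<forall>u\<in>S. \<forall>v\<in>S. (u, v) \<in> (Restr E S)\<^sup>*)"

text \<open>
  Acyclicity is expressed without mentioning paths: deleting a node separates its neighbours.
\<close>

definition rel_tree :: "'t set \<Rightarrow> 't rel \<Rightarrow> bool" where
  "rel_tree V E \<longleftrightarrow>
     finite V \<and> E \<subseteq> V \<times> V \<and> sym E \<and> irrefl E \<and> rel_connected E V \<and>
     (\<forall>v x y. (v, x) \<in> E \<longrightarrow> (v, y) \<in> E \<longrightarrow> (x, y) \<in> (Restr E (- {v}))\<^sup>* \<longrightarrow> x = y)"

lemma arcs_ends_induce_subgraph: "arcs_ends (G \<restriction> S) = Restr (arcs_ends G) S"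
  by (auto simp: arcs_ends_conv)

lemma induce_subgraph_induce_subgraph:
  "S' \<subseteq> S \<Longrightarrow> (G \<restriction> S) \<restriction> S' = G \<restriction> S'"
  by (auto simp: induce_subgraph_def)

lemma connected_iff_rel_connected:
  assumes "wf_digraph G" "symmetric G"
  shows "connected G \<longleftrightarrow> rel_connected (arcs_ends G) (verts G)"
proof -
  interpret wf_digraph G by fact
  have R: "Restr (arcs_ends G) (verts G) = arcs_ends G"
    using adj_in_verts by auto
  \<comment> \<open>\<open>connected\<close> refers to reachability in the symmetric closure, which
    for a symmetric graph is reachability in \<open>G\<close> itself.\<close>
  have "u \<rightarrow>\<^sup>*\<^bsub>mk_symmetric G\<^esub> v \<longleftrightarrow> (u, v) \<in> (arcs_ends G)\<^sup>*" if "u \<in> verts G" for u v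
    using reachable_mk_symmetric_eq[OF assms(2)] reachable_conv'[OF that] by simp
  then show ?thesis
    unfolding connected_def strongly_connected_def rel_connected_def R
    by (auto simp: mk_symmetric_def)
qed

lemma connected_induce_subgraph_iff:
  assumes "wf_digraph G" "symmetric G" "S \<subseteq> verts G"
  shows "connected (G \<restriction> S) \<longleftrightarrow> rel_connected (arcs_ends G) S"
proof -
  have "symmetric (G \<restriction> S)"
    using assms(2) by (auto simp: symmetric_def arcs_ends_induce_subgraph sym_def)
  moreover have "wf_digraph (G \<restriction> S)"
    using assms by (simp add: wf_digraph.wellformed_induce_subgraph)
  moreover have "Restr (Restr (arcs_ends G) S) S = Restr (arcs_ends G) S" by auto
  ultimately show ?thesis
    by (simp add: connected_iff_rel_connected arcs_ends_induce_subgraph rel_connected_def)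
qed

section \<open>Cycles and the separation of neighbours\<close>

lemma rtrancl_avoiding_if_pcas:
  assumes "pcas x p y" "set p \<subseteq> E" "u \<notin> set (pawalk_verts x p)"
  shows "(x, y) \<in> (Restr E (- {u}))\<^sup>*"
  using assms
proof (induction p arbitrary: x)
  case (Cons e p)
  have "snd e \<noteq> u" using Cons.prems(1,3) by (cases p) (auto split: prod.splits)
  then have "(x, snd e) \<in> Restr E (- {u})" using Cons.prems by (cases e) auto
  then show ?case using Cons by (auto intro: converse_rtrancl_into_rtrancl)
qed simp

lemma pawalk_verts_snoc:
  "pcas x p (fst e) \<Longrightarrow> pawalk_verts x (p @ [e]) = pawalk_verts x p @ [snd e]"
  by (induction p arbitrary: x) auto

text \<open>Deleting a node \<open>v\<close> from a cycle through it leaves a walk between its two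
  neighbours on the cycle. Conversely, a path between two neighbours that avoids \<open>v\<close>
  closes up through \<open>v\<close>. Distinctness of the neighbours corresponds to length at least
  3.\<close>

lemma cycle_iff_neighbours_connected:
  assumes "graph (with_proj T)"
  shows "(\<exists>p. pre_digraph.cycle (with_proj T) p \<and> length p \<ge> 3) \<longleftrightarrow>
    (\<exists>v x y. (v, x) \<in> parcs T \<and> (v, y) \<in> parcs T \<and>
       (x, y) \<in> (Restr (parcs T) (- {v}))\<^sup>* \<and> x \<noteq> y)" (is "?L \<longleftrightarrow> ?R")
proof
  interpret T: pair_graph T using assms by (rule pair_graphI_graph)
  assume ?L
  then obtain p u where p: "T.awalk u p u" "distinct (tl (pawalk_verts u p))" "length p \<ge> 3"
    by (auto simp: T.cycle_def)
  then obtain e q where q: "p = e # q" "length q \<ge> 2" by (cases p) auto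
  \<comment> \<open>Length at least 3 leaves a nonempty middle part \<open>r\<close> between the
    first arc \<open>e\<close> and the last arc \<open>e'\<close>.\<close>
  then obtain r e' where r: "q = r @ [e']" "r \<noteq> []" by (cases q rule: rev_cases) fastforce+
  have w: "T.awalk (snd e) r (fst e')" "fst e = u" "snd e' = u" "e \<in> parcs T" "e' \<in> parcs T"
    using p(1) unfolding q(1) r(1)
    by (auto simp: T.awalk_Cons_iff T.awalk_append_iff)
  have d: "distinct (pawalk_verts (snd e) (r @ [e']))" using p(2) q(1) r(1) by simp
  \<comment> \<open>The cycle ends in \<open>u\<close>, so distinctness keeps \<open>u\<close> out
    of the middle part.\<close>
  have "pawalk_verts (snd e) (r @ [e']) = pawalk_verts (snd e) r @ [u]"
    using w(1,3) by (simp add: pawalk_verts_snoc T.awalk_def)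
  with d have d': "distinct (pawalk_verts (snd e) r)" "u \<notin> set (pawalk_verts (snd e) r)"
    by auto
  have "(snd e, fst e') \<in> (Restr (parcs T) (- {u}))\<^sup>*"
    using w(1) d'(2) by (intro rtrancl_avoiding_if_pcas) (auto simp: T.awalk_def)
  \<comment> \<open>A nonempty path has distinct ends.\<close>
  moreover have "snd e \<noteq> fst e'"
    using T.apath_nonempty_ends[of "snd e" r "fst e'"] w(1) d'(1) r(2)
    by (auto simp: T.apath_def)
  moreover have "(u, snd e) \<in> parcs T" "(u, fst e') \<in> parcs T"
    using w T.arcs_symmetric by (metis prod.collapse)+
  ultimately show ?R by blast
next
  interpret T: pair_graph T using assms by (rule pair_graphI_graph)
  assume ?R
  then obtain v x y where vxy: "(v, x) \<in> parcs T" "(v, y) \<in> parcs T"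
    "(x, y) \<in> (Restr (parcs T) (- {v}))\<^sup>*" "x \<noteq> y" by blast
  \<comment> \<open>With \<open>v\<close> deleted, reachability yields a simple path that avoids
    \<open>v\<close>.\<close>
  define T' where "T' = \<lparr>pverts = pverts T - {v}, parcs = Restr (parcs T) (- {v})\<rparr>"
  interpret T': pair_wf_digraph T'
    by unfold_locales (auto simp: T'_def T.in_arcsD1 T.in_arcsD2)
  have "x \<in> pverts T'"
    using vxy(1) T.in_arcsD2 T.no_loops' by (auto simp: T'_def)
  then have "x \<rightarrow>\<^sup>*\<^bsub>with_proj T'\<^esub> y"
    using vxy(3) T'.reachable_conv'[of x y] by (simp add: T'_def)
  then obtain p where p: "T'.apath x p y" using T'.reachable_apath by blast
  then have p': "T'.awalk x p y" "distinct (pawalk_verts x p)" by (auto simp: T'.apath_def)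
  have "p \<noteq> []" using p' \<open>x \<noteq> y\<close> by (auto simp: T'.awalk_Nil_iff)
  have "set (pawalk_verts x p) \<subseteq> pverts T'"
    using T'.awalk_verts_in_verts p'(1) T'.awalkE' by (metis subsetI T'.awalk_hd_in_verts)
  then have "v \<notin> set (pawalk_verts x p)" by (auto simp: T'_def)
  have "T.awalk x p y"
    using p'(1) unfolding T.awalk_def T'.awalk_def by (auto simp: T'_def)
  moreover have "T.awalk y [(y, v)] v" "T.awalk v [(v, x)] x"
    using vxy T.arcs_symmetric by (auto simp: T.awalk_simps T.in_arcsD1 T.in_arcsD2)
  ultimately have c: "T.awalk v ((v, x) # p @ [(y, v)]) v"
    by (auto simp: T.awalk_simps)
  have "pawalk_verts x (p @ [(y, v)]) = pawalk_verts x p @ [v]"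
    using p'(1) by (simp add: pawalk_verts_snoc T'.awalk_def)
  then have "T.cycle ((v, x) # p @ [(y, v)])"
    using c p'(2) \<open>v \<notin> set (pawalk_verts x p)\<close> by (auto simp: T.cycle_def)
  then show ?L using \<open>p \<noteq> []\<close> by (intro exI[of _ "(v, x) # p @ [(y, v)]"]) (cases p, auto)
qed

lemma undirected_tree_with_proj_iff:
  "undirected_tree (with_proj T) \<longleftrightarrow> rel_tree (pverts T) (parcs T)"
proof (cases "graph (with_proj T)")
  case True
  then interpret T: pair_graph T by (rule pair_graphI_graph)
  have "irrefl (parcs T)" using T.no_loops' by (auto simp: irrefl_def)
  moreover have "sym (parcs T)" using T.arcs_symmetric by (auto simp: sym_def)
  moreover have "parcs T \<subseteq> pverts T \<times> pverts T" using T.in_arcsD1 T.in_arcsD2 by auto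
  moreover have "connected (with_proj T) \<longleftrightarrow> rel_connected (parcs T) (pverts T)"
    using connected_iff_rel_connected[of "with_proj T"] T.wf_digraph T.sym_arcs by simp
  ultimately show ?thesis
    unfolding undirected_tree_def rel_tree_def cycle_iff_neighbours_connected[OF True]
    using True T.pair_finite_verts by blast
next
  case False
  \<comment> \<open>Both sides are false in this case, because \<open>rel_tree\<close> already
    forces \<open>T\<close> to be a graph.\<close>
  have "pair_graph T" if t: "rel_tree (pverts T) (parcs T)"
  proof
    show "finite (parcs T)"
      using t finite_subset[of "parcs T" "pverts T \<times> pverts T"] by (auto simp: rel_tree_def)
  qed (use t in \<open>auto simp: rel_tree_def symmetric_def irrefl_def\<close>)
  then show ?thesis using False pair_graph.pair_graphD_graph by (auto simp: undirected_tree_def)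
qed

section \<open>The Helly property of subtrees\<close>

text \<open>
  Root the tree at \<open>r\<close> and let \<open>d\<close> be the distance to \<open>r\<close>. Two neighbours of \<open>v\<close> that are not
  farther from \<open>r\<close> than \<open>v\<close> are connected through \<open>r\<close> without using \<open>v\<close>, hence are equal.
\<close>

lemma rel_tree_parent:
  assumes "rel_tree V E"
  obtains d :: "'t \<Rightarrow> nat" and par :: "'t \<Rightarrow> 't"
  where "\<And>x y. (x, y) \<in> E \<Longrightarrow>
    y = par x \<and> d x = Suc (d y) \<or> x = par y \<and> d y = Suc (d x)"
proof -
  have EV: "E \<subseteq> V \<times> V" and symE: "sym E" and irr: "irrefl E" and conn: "rel_connected E V"
    and acyc: "\<And>v x y. (v, x) \<in> E \<Longrightarrow> (v, y) \<in> E \<Longrightarrow> (x, y) \<in> (Restr E (- {v}))\<^sup>* \<Longrightarrow> x = y"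
    using assms unfolding rel_tree_def by blast+
  obtain r where r: "r \<in> V" using conn by (auto simp: rel_connected_def)
  define d where "d x = (LEAST n. (x, r) \<in> E ^^ n)" for x
  have d_relpow: "(x, r) \<in> E ^^ d x" if "x \<in> V" for x
  proof -
    have "Restr E V = E" using EV by auto
    then have "(x, r) \<in> E\<^sup>*" using conn that r by (auto simp: rel_connected_def)
    then show ?thesis unfolding d_def by (metis LeastI_ex rtrancl_imp_relpow)
  qed
  have d_le: "d x \<le> n" if "(x, r) \<in> E ^^ n" for x n
    unfolding d_def using that by (rule Least_le)
  have d_step: "d x \<le> Suc (d y)" if "(x, y) \<in> E" for x y
    using that EV by (intro d_le relpow_Suc_I2[OF _ d_relpow]) auto
  \<comment> \<open>The witness is the second node of a shortest walk from \<open>x\<close> to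
    \<open>r\<close>.\<close>
  have ex_parent: "\<exists>y. (x, y) \<in> E \<and> d x = Suc (d y)" if x: "x \<in> V" "x \<noteq> r" for x
  proof (cases "d x")
    case 0
    then show ?thesis using d_relpow[OF x(1)] x(2) by simp
  next
    case (Suc n)
    then obtain y where y: "(x, y) \<in> E" "(y, r) \<in> E ^^ n"
      using d_relpow[OF x(1)] by (metis relpow_Suc_D2)
    then show ?thesis using d_le[of y n] d_step[of x y] Suc by auto
  qed
  \<comment> \<open>Descend to the root. Every node after \<open>u\<close> is strictly closer to
    \<open>r\<close> than \<open>v\<close>, so the walk never meets \<open>v\<close>.\<close>
  have to_root: "(u, r) \<in> (Restr E (- {v}))\<^sup>*" if "u \<in> V" "u \<noteq> v" "d u \<le> d v" for u v
    using that
  proof (induction "d u" arbitrary: u rule: less_induct)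
    case less
    show ?case
    proof (cases "u = r")
      case False
      then obtain y where y: "(u, y) \<in> E" "d u = Suc (d y)" using ex_parent less.prems by blast
      then have "y \<noteq> v" using less.prems by auto
      then have "(y, r) \<in> (Restr E (- {v}))\<^sup>*" using y less EV by auto
      moreover have "(u, y) \<in> Restr E (- {v})" using y \<open>y \<noteq> v\<close> less.prems by auto
      ultimately show ?thesis by (rule converse_rtrancl_into_rtrancl[rotated])
    qed simp
  qed
  have unique: "x = y" if "(v, x) \<in> E" "(v, y) \<in> E" "d x \<le> d v" "d y \<le> d v" for v x y
  proof -
    have "(x, r) \<in> (Restr E (- {v}))\<^sup>*" "(y, r) \<in> (Restr E (- {v}))\<^sup>*"
      using that EV irr by (auto intro!: to_root simp: irrefl_def)
    moreover have "sym ((Restr E (- {v}))\<^sup>*)"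
      using symE by (intro sym_rtrancl) (auto simp: sym_def)
    ultimately show ?thesis using acyc that(1,2) by (meson rtrancl_trans symD)
  qed
  \<comment> \<open>By \<open>unique\<close> this choice is forced at every node except
    \<open>r\<close>, where the value is arbitrary.\<close>
  define par where "par x = (SOME y. (x, y) \<in> E \<and> d x = Suc (d y))" for x
  \<comment> \<open>This also excludes edges between nodes of equal depth: \<open>y\<close> must be
    \<open>par x\<close>, which is strictly closer to \<open>r\<close>.\<close>
  have lower: "y = par x \<and> d x = Suc (d y)" if "(x, y) \<in> E" "d y \<le> d x" for x y
  proof -
    have "x \<noteq> r"
    proof
      assume "x = r"
      then have "d x = 0" using d_le[of r 0] by simp
      then have "y = r" using that d_relpow[of y] EV by auto
      with that \<open>x = r\<close> irr show False by (auto simp: irrefl_def)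
    qed
    then have "\<exists>y. (x, y) \<in> E \<and> d x = Suc (d y)" using ex_parent that EV by auto
    then have "(x, par x) \<in> E \<and> d x = Suc (d (par x))" unfolding par_def by (rule someI_ex)
    with unique[of x y "par x"] that show ?thesis by simp
  qed
  show thesis
  proof (rule that)
    fix x y assume "(x, y) \<in> E"
    then show "y = par x \<and> d x = Suc (d y) \<or> x = par y \<and> d y = Suc (d x)"
      using lower[of x y] lower[of y x] symD[OF symE] by (cases "d y \<le> d x") auto
  qed
qed

text \<open>Each subtree has a top node and contains the chain of parents from any of its nodes up
  to that top. The deepest of all tops lies in every subtree: starting from a node common to two
  subtrees, the chain to the higher top passes through the deeper one.\<close>

lemma rel_tree_Helly:
  assumes tree: "rel_tree V E" and "finite I" "I \<noteq> {}"
    and conn: "\<And>i. i \<in> I \<Longrightarrow> rel_connected E (S i)"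
    and meet: "\<And>i j. i \<in> I \<Longrightarrow> j \<in> I \<Longrightarrow> S i \<inter> S j \<noteq> {}"
  shows "\<exists>t. \<forall>i\<in>I. t \<in> S i"
proof -
  obtain d :: "'a \<Rightarrow> nat" and par where
    par: "\<And>x y. (x, y) \<in> E \<Longrightarrow>
      y = par x \<and> d x = Suc (d y) \<or> x = par y \<and> d y = Suc (d x)"
    using rel_tree_parent[OF tree] by metis
  \<comment> \<open>The top of \<open>S i\<close>, a node of least depth.\<close>
  define m where "m i = arg_min_on d (S i)" for i
  have m: "m i \<in> S i" "\<And>x. x \<in> S i \<Longrightarrow> d (m i) \<le> d x" if "i \<in> I" for i
  proof -
    have "S i \<noteq> {}" using conn[OF that] by (simp add: rel_connected_def)
    then obtain z where "z \<in> S i" by blast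
    then show "m i \<in> S i" "\<And>x. x \<in> S i \<Longrightarrow> d (m i) \<le> d x"
      unfolding m_def arg_min_on_def
      by (auto intro: arg_min_natI arg_min_nat_le)
  qed
  \<comment> \<open>Induction along a walk inside \<open>S i\<close> from \<open>x\<close> to
    \<open>m i\<close>. No subtraction is truncated, since \<open>m i\<close> has least depth in
    \<open>S i\<close>.\<close>
  have ancestors: "(par ^^ (d x - d (m i))) x = m i \<and>
      (\<forall>k \<le> d x - d (m i). (par ^^ k) x \<in> S i)"
    if "i \<in> I" "x \<in> S i" for i x
  proof -
    have "(x, m i) \<in> (Restr E (S i))\<^sup>*"
      using conn[OF that(1)] m(1)[OF that(1)] that(2) by (simp add: rel_connected_def)
    then show ?thesis
    proof (induction rule: converse_rtrancl_induct)
      case base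
      then show ?case using m(1)[OF that(1)] by simp
    next
      case (step x y)
      have le: "d (m i) \<le> d x" "d (m i) \<le> d y" using m(2)[OF that(1)] step(1) by auto
      from par[of x y] step(1) consider
        "y = par x" "d x = Suc (d y)" | "x = par y" "d y = Suc (d x)" by auto
      then show ?case
      proof cases
        \<comment> \<open>The walk goes up, so the chain of \<open>x\<close> is \<open>x\<close>
          followed by the chain of \<open>y\<close>.\<close>
        case 1
        then have k: "d x - d (m i) = Suc (d y - d (m i))" using le by simp
        have "(par ^^ k) x \<in> S i" if "k \<le> Suc (d y - d (m i))" for k
        proof (cases k)
          case 0
          then show ?thesis using step(1) by simp
        next
          case (Suc k')
          then show ?thesis using that step.IH 1(1) by (simp del: funpow.simps add: funpow_Suc_right)
        qed
        then show ?thesis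
          using step.IH 1(1) unfolding k by (simp del: funpow.simps add: funpow_Suc_right)
      next
        \<comment> \<open>The walk goes down, so the chain of \<open>x\<close> is the chain of
          \<open>y\<close> without its first node.\<close>
        case 2
        then have k: "d y - d (m i) = Suc (d x - d (m i))" using le by simp
        have shift: "(par ^^ k) x = (par ^^ Suc k) y" for k
          using 2(1) by (simp del: funpow.simps add: funpow_Suc_right)
        show ?thesis
          using step.IH unfolding k shift by (simp del: funpow.simps)
      qed
    qed
  qed
  have "Max ((\<lambda>i. d (m i)) ` I) \<in> (\<lambda>i. d (m i)) ` I"
    using \<open>finite I\<close> \<open>I \<noteq> {}\<close> by (intro Max_in) auto
  \<comment> \<open>The deepest top, \<open>m i\<close>, is going to be the common node.\<close>
  then obtain i where "i \<in> I" "d (m i) = Max ((\<lambda>i. d (m i)) ` I)" by auto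
  with \<open>finite I\<close> have i: "i \<in> I" "\<And>j. j \<in> I \<Longrightarrow> d (m j) \<le> d (m i)" by auto
  have "m i \<in> S j" if j: "j \<in> I" for j
  proof -
    obtain x where x: "x \<in> S i" "x \<in> S j" using meet[OF i(1) j] by blast
    \<comment> \<open>Hence climbing from \<open>x\<close> meets \<open>m i\<close> no later than
      \<open>m j\<close>, while still inside \<open>S j\<close>.\<close>
    have "d x - d (m i) \<le> d x - d (m j)" using i(2)[OF j] by simp
    then show ?thesis using ancestors[OF i(1) x(1)] ancestors[OF j x(2)] by metis
  qed
  then show ?thesis by blast
qed

section \<open>Joining two trees by an edge\<close>

lemma rtrancl_map_prod_iff:
  assumes "inj f"
  shows "(f x, f y) \<in> (map_prod f f ` E)\<^sup>* \<longleftrightarrow> (x, y) \<in> E\<^sup>*"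
proof
  \<comment> \<open>The endpoint is generalised to \<open>z\<close>: the induction must show that a
    walk starting at \<open>f x\<close> never leaves the range of \<open>f\<close>.\<close>
  have "\<exists>y. z = f y \<and> (x, y) \<in> E\<^sup>*" if "(f x, z) \<in> (map_prod f f ` E)\<^sup>*" for z
    using that
  proof (induction rule: rtrancl_induct)
    case (step y z)
    then show ?case using assms by (auto dest!: injD intro: rtrancl_into_rtrancl)
  qed auto
  then show "(x, y) \<in> E\<^sup>*" if "(f x, f y) \<in> (map_prod f f ` E)\<^sup>*"
    using that assms by (metis injD)
  show "(f x, f y) \<in> (map_prod f f ` E)\<^sup>*" if "(x, y) \<in> E\<^sup>*"
    using that by (induction rule: rtrancl_induct) (auto intro: rtrancl_into_rtrancl)
qed

lemma rel_connected_image_iff: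
  assumes "inj f"
  shows "rel_connected (map_prod f f ` E) (f ` S) \<longleftrightarrow> rel_connected E S"
proof -
  have "Restr (map_prod f f ` E) (f ` S) = map_prod f f ` Restr E S"
    using assms by (auto dest: injD)
  then show ?thesis by (simp add: rel_connected_def rtrancl_map_prod_iff[OF assms])
qed

text \<open>Two trees over the same node type are made disjoint by renaming before they are joined.
  Acyclicity holds because injectivity lets walks be pulled back along \<open>f\<close>.\<close>

lemma rel_tree_image:
  assumes "inj f" "rel_tree V E"
  shows "rel_tree (f ` V) (map_prod f f ` E)"
proof -
  have "Restr (map_prod f f ` E) (- {f v}) = map_prod f f ` Restr E (- {v})" for v
    using assms(1) by (auto dest: injD)
  then have sep: "f x = f y"
    if "(v, x) \<in> E" "(v, y) \<in> E" "(f x, f y) \<in> (Restr (map_prod f f ` E) (- {f v}))\<^sup>*" for v x y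
    using assms that by (simp add: rtrancl_map_prod_iff rel_tree_def) blast
  have "a = b"
    if c: "(c, a) \<in> map_prod f f ` E" "(c, b) \<in> map_prod f f ` E"
      "(a, b) \<in> (Restr (map_prod f f ` E) (- {c}))\<^sup>*" for a b c
  proof -
    obtain v x where vx: "(v, x) \<in> E" "c = f v" "a = f x" using c(1) by auto
    obtain y where "(v, y) \<in> E" "b = f y" using c(2) vx(2) injD[OF assms(1)] by auto
    then show ?thesis using sep vx c(3) by simp
  qed
  moreover have "sym (map_prod f f ` E)" "irrefl (map_prod f f ` E)"
    "map_prod f f ` E \<subseteq> f ` V \<times> f ` V"
    using assms by (auto simp: rel_tree_def sym_def irrefl_def dest: injD)
  ultimately show ?thesis
    using assms by (simp add: rel_tree_def rel_connected_image_iff)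
qed

section \<open>Adding an edge between two disjoint trees\<close>

lemma rel_connected_mono:
  assumes "rel_connected E S" "E \<subseteq> E'"
  shows "rel_connected E' S"
  using assms rtrancl_mono[of "Restr E S" "Restr E' S"] by (auto simp: rel_connected_def)

text \<open>All nodes reach each other through \<open>a\<close>. This serves both for the joined
  tree and for the nodes whose bags contain a given vertex of the clique.\<close>

lemma rel_connected_bridge:
  assumes "rel_connected E S\<^sub>1" "rel_connected E S\<^sub>2"
    and ab: "a \<in> S\<^sub>1" "b \<in> S\<^sub>2" "(a, b) \<in> E" "(b, a) \<in> E"
  shows "rel_connected E (S\<^sub>1 \<union> S\<^sub>2)"
proof -
  let ?R = "(Restr E (S\<^sub>1 \<union> S\<^sub>2))\<^sup>*"
  have "(Restr E S\<^sub>1)\<^sup>* \<subseteq> ?R" "(Restr E S\<^sub>2)\<^sup>* \<subseteq> ?R" by (intro rtrancl_mono; auto)+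
  then have "\<forall>u\<in>S\<^sub>1. (u, a) \<in> ?R \<and> (a, u) \<in> ?R" "\<forall>u\<in>S\<^sub>2. (u, b) \<in> ?R \<and> (b, u) \<in> ?R"
    using assms by (auto simp: rel_connected_def)
  moreover have "(a, b) \<in> ?R" "(b, a) \<in> ?R" using ab by auto
  ultimately have hub: "(u, a) \<in> ?R \<and> (a, u) \<in> ?R" if "u \<in> S\<^sub>1 \<union> S\<^sub>2" for u
    using that by (meson Un_iff rtrancl_trans)
  then have "(u, v) \<in> ?R" if "u \<in> S\<^sub>1 \<union> S\<^sub>2" "v \<in> S\<^sub>1 \<union> S\<^sub>2" for u v
    using rtrancl_trans[of u a _ v] hub[OF that(1)] hub[OF that(2)] by blast
  then show ?thesis using ab(1) unfolding rel_connected_def by blast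
qed

text \<open>Acyclicity of the joined tree at a node of the first tree; exchanging the trees covers
  the second. Deleting \<open>a\<close> also deletes the bridge, which confines a walk to one side.
  For any other \<open>v\<close>, an excursion into the second tree leaves from \<open>a\<close> and
  returns to \<open>a\<close>, so it can be cut out.\<close>

lemma bridge_neighbours_separated:
  assumes t\<^sub>1: "rel_tree V\<^sub>1 E\<^sub>1" and t\<^sub>2: "rel_tree V\<^sub>2 E\<^sub>2" and disj: "V\<^sub>1 \<inter> V\<^sub>2 = {}"
    and ab: "a \<in> V\<^sub>1" "b \<in> V\<^sub>2"
    and E: "E = E\<^sub>1 \<union> E\<^sub>2 \<union> {(a, b), (b, a)}"
    and v: "v \<in> V\<^sub>1" "(v, x) \<in> E" "(v, y) \<in> E" "(x, y) \<in> (Restr E (- {v}))\<^sup>*"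
  shows "x = y"
proof -
  have E\<^sub>1: "E\<^sub>1 \<subseteq> V\<^sub>1 \<times> V\<^sub>1" and E\<^sub>2: "E\<^sub>2 \<subseteq> V\<^sub>2 \<times> V\<^sub>2"
    using t\<^sub>1 t\<^sub>2 by (auto simp: rel_tree_def)
  have acyc: "x = y"
    if "(v, x) \<in> E\<^sub>1" "(v, y) \<in> E\<^sub>1" "(x, y) \<in> (Restr E\<^sub>1 (- {v}))\<^sup>*" for x y
    using t\<^sub>1 that unfolding rel_tree_def by blast
  show ?thesis
  proof (cases "v = a")
    case True
    \<comment> \<open>With \<open>a\<close> deleted, no remaining arc changes sides.\<close>
    have "(z \<in> V\<^sub>1 \<longleftrightarrow> x \<in> V\<^sub>1) \<and> (x \<in> V\<^sub>1 \<longrightarrow> (x, z) \<in> (Restr E\<^sub>1 (- {v}))\<^sup>*)"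
      if "(x, z) \<in> (Restr E (- {v}))\<^sup>*" for z
      using that
    proof (induction rule: rtrancl_induct)
      case (step y z)
      then have "(y, z) \<in> Restr E\<^sub>1 (- {v}) \<or> y \<in> V\<^sub>2 \<and> z \<in> V\<^sub>2"
        using True E\<^sub>2 by (auto simp: E)
      then show ?case
      proof
        assume "(y, z) \<in> Restr E\<^sub>1 (- {v})"
        then show ?thesis using step.IH E\<^sub>1 by (auto intro: rtrancl_into_rtrancl)
      qed (use step.IH disj in blast)
    qed simp
    with v(4) have xy: "y \<in> V\<^sub>1 \<longleftrightarrow> x \<in> V\<^sub>1" "x \<in> V\<^sub>1 \<Longrightarrow> (x, y) \<in> (Restr E\<^sub>1 (- {v}))\<^sup>*"
      by blast+
    show ?thesis
    proof (cases "x \<in> V\<^sub>1")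
      case True
      then have "(v, x) \<in> E\<^sub>1" "(v, y) \<in> E\<^sub>1"
        using v xy E\<^sub>2 ab disj by (auto simp: E)
      then show ?thesis using acyc xy(2)[OF True] by blast
    next
      case False
      \<comment> \<open>The only neighbour of \<open>a\<close> in the second tree is
        \<open>b\<close>.\<close>
      then have "x = b" "y = b" using v(1-3) xy(1) E\<^sub>1 E\<^sub>2 ab disj by (auto simp: E)
      then show ?thesis by simp
    qed
  next
    case False
    \<comment> \<open>Contract the second tree to \<open>a\<close>.\<close>
    define c where "c z = (if z \<in> V\<^sub>1 then z else a)" for z
    have "(c x, c y) \<in> (Restr E\<^sub>1 (- {v}))\<^sup>*" using v(4)
    proof (induction rule: rtrancl_induct)
      case (step y z)
      \<comment> \<open>Arcs of \<open>E\<^sub>2\<close> and the bridge collapse to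
        \<open>a\<close>, while arcs of \<open>E\<^sub>1\<close> are unchanged.\<close>
      then have "c y = c z \<or> (c y, c z) \<in> Restr E\<^sub>1 (- {v})"
        using E\<^sub>1 E\<^sub>2 ab disj by (auto simp: E c_def)
      then show ?case using step.IH by (auto intro: rtrancl_into_rtrancl)
    qed simp
    moreover have "(v, x) \<in> E\<^sub>1" "(v, y) \<in> E\<^sub>1"
      using v(1-3) E\<^sub>2 ab disj False by (auto simp: E)
    \<comment> \<open>Since \<open>v\<close> is not \<open>a\<close>, its neighbours lie in
      \<open>V\<^sub>1\<close>, where \<open>c\<close> is the identity.\<close>
    moreover from this have "c x = x" "c y = y" using E\<^sub>1 by (auto simp: c_def)
    ultimately show ?thesis using acyc by metis
  qed
qed

lemma rel_tree_bridge:
  assumes t\<^sub>1: "rel_tree V\<^sub>1 E\<^sub>1" and t\<^sub>2: "rel_tree V\<^sub>2 E\<^sub>2" and disj: "V\<^sub>1 \<inter> V\<^sub>2 = {}"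
    and ab: "a \<in> V\<^sub>1" "b \<in> V\<^sub>2"
  shows "rel_tree (V\<^sub>1 \<union> V\<^sub>2) (E\<^sub>1 \<union> E\<^sub>2 \<union> {(a, b), (b, a)})"
    (is "rel_tree ?V ?E")
proof -
  have "rel_connected ?E V\<^sub>1" "rel_connected ?E V\<^sub>2"
    using t\<^sub>1 t\<^sub>2 by (auto simp: rel_tree_def intro: rel_connected_mono)
  then have "rel_connected ?E ?V" using ab by (intro rel_connected_bridge) auto
  moreover have EV: "?E \<subseteq> ?V \<times> ?V" using t\<^sub>1 t\<^sub>2 ab by (auto simp: rel_tree_def)
  moreover have "sym ?E" using t\<^sub>1 t\<^sub>2 by (auto simp: rel_tree_def sym_def)
  moreover have "irrefl ?E" using t\<^sub>1 t\<^sub>2 ab disj by (auto simp: rel_tree_def irrefl_def)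
  moreover have "x = y" if "(v, x) \<in> ?E" "(v, y) \<in> ?E" "(x, y) \<in> (Restr ?E (- {v}))\<^sup>*" for v x y
  proof (cases "v \<in> V\<^sub>1")
    case True
    then show ?thesis using bridge_neighbours_separated[OF t\<^sub>1 t\<^sub>2 disj ab refl] that by blast
  next
    \<comment> \<open>The same argument with the two trees exchanged.\<close>
    case False
    then have "v \<in> V\<^sub>2" using that EV by auto
    moreover have "?E = E\<^sub>2 \<union> E\<^sub>1 \<union> {(b, a), (a, b)}" by auto
    ultimately show ?thesis
      using bridge_neighbours_separated[OF t\<^sub>2 t\<^sub>1 _ ab(2,1)] that disj by (metis Int_commute)
  qed
  ultimately show ?thesis
    using t\<^sub>1 t\<^sub>2 unfolding rel_tree_def by blast
qed

section \<open>Tree decompositions\<close>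

text \<open>That every vertex lies in some bag is part of the last condition, through the
  nonemptiness in \<open>rel_connected\<close>.\<close>

definition rel_decomposition ::
  "('a, 'b) pre_digraph \<Rightarrow> 't set \<Rightarrow> 't rel \<Rightarrow> ('t \<Rightarrow> 'a set) \<Rightarrow> bool" where
  "rel_decomposition G V E X \<longleftrightarrow>
     rel_tree V E \<and>
     (\<forall>t\<in>V. X t \<subseteq> verts G) \<and>
     (\<forall>u v. u \<rightarrow>\<^bsub>G\<^esub> v \<longrightarrow> (\<exists>t\<in>V. u \<in> X t \<and> v \<in> X t)) \<and>
     (\<forall>u\<in>verts G. rel_connected E {t \<in> V. u \<in> X t})"

lemma tree_decomposition_with_proj_iff:
  "tree_decomposition G (with_proj T) X \<longleftrightarrow> rel_decomposition G (pverts T) (parcs T) X"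
proof (cases "undirected_tree (with_proj T)")
  case True
  then interpret T: pair_graph T
    by (auto simp: undirected_tree_def intro: pair_graphI_graph)
  have "connected (with_proj T \<restriction> {t \<in> pverts T. P t}) \<longleftrightarrow>
      rel_connected (parcs T) {t \<in> pverts T. P t}" for P
    using connected_induce_subgraph_iff[of "with_proj T" "{t \<in> pverts T. P t}"]
      T.wf_digraph T.sym_arcs by auto
  then show ?thesis
    unfolding tree_decomposition_def rel_decomposition_def undirected_tree_with_proj_iff
    by (auto simp: rel_connected_def)
next
  case False
  then show ?thesis
    by (simp add: tree_decomposition_def rel_decomposition_def undirected_tree_with_proj_iff)
qed

text \<open>A tree has finitely many nodes and at least one, so the \<open>Max\<close> is
  attained.\<close>

lemma decomp_indep_number_le_iff:
  assumes "rel_tree (pverts T) (parcs T)"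
  shows "decomp_indep_number G (with_proj T) X \<le> k \<longleftrightarrow>
    (\<forall>t\<in>pverts T. indep_number (G \<restriction> X t) \<le> k)"
proof -
  have *: "{indep_number (G \<restriction> X t) | t. t \<in> pverts T} = (\<lambda>t. indep_number (G \<restriction> X t)) ` pverts T"
    by auto
  have "finite (pverts T)" "pverts T \<noteq> {}"
    using assms by (auto simp: rel_tree_def rel_connected_def)
  then show ?thesis unfolding decomp_indep_number_def with_proj_simps * by simp
qed

text \<open>The one-bag decomposition guarantees that the minimum in \<open>tree_alpha\<close> is
  taken over a nonempty set.\<close>

lemma rel_decomposition_trivial:
  assumes "wf_digraph G"
  shows "rel_decomposition G {t} {} (\<lambda>_. verts G)"
  using wf_digraph.adj_in_verts[OF assms]
  by (auto simp: rel_decomposition_def rel_tree_def rel_connected_def sym_def irrefl_def)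

text \<open>Turns the minimum of maxima into a bound on each bag separately. Both inequalities of
  the theorem are then proved by exhibiting a decomposition.\<close>

lemma tree_alpha_le_iff:
  assumes "wf_digraph G"
  shows "tree_alpha G \<le> k \<longleftrightarrow>
    (\<exists>(V :: nat set) E X. rel_decomposition G V E X \<and> (\<forall>t\<in>V. indep_number (G \<restriction> X t) \<le> k))"
    (is "?L \<longleftrightarrow> ?R")
proof
  define P where "P k \<longleftrightarrow> (\<exists>(T :: nat pair_pre_digraph) X. tree_decomposition G (with_proj T) X \<and>
    decomp_indep_number G (with_proj T) X = k)" for k
  have alpha: "tree_alpha G = (LEAST k. P k)" by (simp add: tree_alpha_def P_def)
  {
    have "tree_decomposition G (with_proj \<lparr>pverts = {0 :: nat}, parcs = {}\<rparr>) (\<lambda>_. verts G)"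
      using rel_decomposition_trivial[OF assms] by (simp add: tree_decomposition_with_proj_iff)
    then have "\<exists>k. P k" by (auto simp: P_def)
    then have "P (tree_alpha G)" unfolding alpha by (rule LeastI_ex)
    moreover assume ?L
    ultimately obtain T :: "nat pair_pre_digraph" and X
      where "rel_decomposition G (pverts T) (parcs T) X" "decomp_indep_number G (with_proj T) X \<le> k"
      by (auto simp: P_def tree_decomposition_with_proj_iff)
    moreover from this have "\<forall>t\<in>pverts T. indep_number (G \<restriction> X t) \<le> k"
      using decomp_indep_number_le_iff unfolding rel_decomposition_def by blast
    ultimately show ?R by blast
  }
  assume ?R
  then obtain V :: "nat set" and E X where
    VEX: "rel_decomposition G V E X" "\<forall>t\<in>V. indep_number (G \<restriction> X t) \<le> k" by blast
  define T where "T = \<lparr>pverts = V, parcs = E\<rparr>"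
  have "tree_decomposition G (with_proj T) X"
    using VEX by (simp add: T_def tree_decomposition_with_proj_iff)
  then have "tree_alpha G \<le> decomp_indep_number G (with_proj T) X"
    unfolding alpha by (intro Least_le) (auto simp: P_def)
  also have "\<dots> \<le> k"
    using VEX by (subst decomp_indep_number_le_iff) (auto simp: T_def rel_decomposition_def)
  finally show ?L .
qed

section \<open>Passing to induced subgraphs\<close>

lemma indep_number_induce_mono:
  assumes "finite S'" "S \<subseteq> S'"
  shows "indep_number (G \<restriction> S) \<le> indep_number (G \<restriction> S')"
proof -
  let ?A = "\<lambda>S. {card I | I. indep_set (G \<restriction> S) I}"
  have "?A S' \<subseteq> card ` Pow S'" by (auto simp: indep_set_def)
  then have "finite (?A S')" using assms(1) by (meson finite_Pow_iff finite_imageI finite_subset)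
  moreover have "?A S \<subseteq> ?A S'"
    using assms(2) by (auto simp: indep_set_def arcs_ends_induce_subgraph) blast
  \<comment> \<open>The empty set is independent, so the smaller \<open>Max\<close> ranges over a
    nonempty set.\<close>
  moreover have "0 \<in> ?A S" by (auto simp: indep_set_def intro!: exI[of _ "{}"])
  ultimately show ?thesis unfolding indep_number_def by (intro Max_mono) auto
qed

lemma tree_alpha_induce_subgraph_le:
  assumes "fin_digraph G" "S \<subseteq> verts G"
  shows "tree_alpha (G \<restriction> S) \<le> tree_alpha G"
proof -
  interpret fin_digraph G by fact
  obtain V :: "nat set" and E X where VEX: "rel_decomposition G V E X"
    and le: "\<And>t. t \<in> V \<Longrightarrow> indep_number (G \<restriction> X t) \<le> tree_alpha G"
    using tree_alpha_le_iff[OF wf_digraph, of "tree_alpha G"] by blast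
  have "rel_decomposition (G \<restriction> S) V E (\<lambda>t. X t \<inter> S)"
    unfolding rel_decomposition_def
  proof (intro conjI ballI allI impI)
    fix u assume "u \<in> verts (G \<restriction> S)"
    then have "u \<in> S" by simp
    \<comment> \<open>For a vertex of \<open>S\<close> the set of its nodes does not change, so
      connectivity carries over.\<close>
    then have "{t \<in> V. u \<in> X t \<inter> S} = {t \<in> V. u \<in> X t}" by auto
    with VEX assms(2) \<open>u \<in> S\<close> show "rel_connected E {t \<in> V. u \<in> X t \<inter> S}"
      by (auto simp: rel_decomposition_def)
  next
    fix u v assume "u \<rightarrow>\<^bsub>G \<restriction> S\<^esub> v"
    then show "\<exists>t\<in>V. u \<in> X t \<inter> S \<and> v \<in> X t \<inter> S"
      using VEX by (auto simp: rel_decomposition_def arcs_ends_induce_subgraph)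
  qed (use VEX in \<open>auto simp: rel_decomposition_def\<close>)
  moreover have "indep_number ((G \<restriction> S) \<restriction> (X t \<inter> S)) \<le> tree_alpha G" if "t \<in> V" for t
  proof -
    have "finite (X t)" using VEX that finite_subset[OF _ finite_verts]
      by (auto simp: rel_decomposition_def)
    then have "indep_number (G \<restriction> (X t \<inter> S)) \<le> indep_number (G \<restriction> X t)"
      by (intro indep_number_induce_mono) auto
    then show ?thesis using le[OF that] by (simp add: induce_subgraph_induce_subgraph)
  qed
  ultimately show ?thesis
    using tree_alpha_le_iff[OF wellformed_induce_subgraph] by blast
qed

section \<open>Gluing two decompositions along a clique\<close>

lemma rel_decomposition_image:
  assumes "inj f" "rel_decomposition G V E X"
  shows "rel_decomposition G (f ` V) (map_prod f f ` E) (\<lambda>t. X (inv f t))"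
proof -
  have "{t \<in> f ` V. u \<in> X (inv f t)} = f ` {t \<in> V. u \<in> X t}" for u
    using assms(1) by auto
  then show ?thesis
    using assms by (simp add: rel_decomposition_def rel_tree_image rel_connected_image_iff)
qed

text \<open>Helly applied to the family of subtrees indexed by \<open>C\<close>: two of them meet in
  a bag that covers the edge between their vertices.\<close>

lemma clique_subset_bag:
  assumes "rel_decomposition G V E X" "clique G C" "finite C"
  shows "\<exists>t\<in>V. C \<subseteq> X t"
\<comment> \<open>Helly needs a nonempty family; for the empty clique any node will do.\<close>
proof (cases "C = {}")
  case True
  then show ?thesis using assms(1) by (auto simp: rel_decomposition_def rel_tree_def rel_connected_def)
next
  case False
  have C: "C \<subseteq> verts G" using assms(2) by (simp add: clique_def)
  have conn: "rel_connected E {t \<in> V. u \<in> X t}" if "u \<in> C" for u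
    using assms(1) C that by (auto simp: rel_decomposition_def)
  have "{t \<in> V. u \<in> X t} \<inter> {t \<in> V. v \<in> X t} \<noteq> {}" if "u \<in> C" "v \<in> C" for u v
  proof (cases "u = v")
    case True
    then show ?thesis using conn[OF that(1)] by (simp add: rel_connected_def)
  next
    case False
    then have "u \<rightarrow>\<^bsub>G\<^esub> v" using assms(2) that by (auto simp: clique_def pairwise_def)
    then show ?thesis using assms(1) by (fastforce simp: rel_decomposition_def)
  qed
  then have "\<exists>t. \<forall>u\<in>C. t \<in> {t \<in> V. u \<in> X t}"
    using assms(1,3) False conn by (intro rel_tree_Helly[of V E]) (auto simp: rel_decomposition_def)
  \<comment> \<open>A vertex of \<open>C\<close> is needed to conclude that the common node lies in
    \<open>V\<close>.\<close>
  then show ?thesis using False by blast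
qed

text \<open>A vertex of \<open>A\<close> or \<open>B\<close> occurs in one tree only, so its nodes
  remain connected. The two subtrees of a vertex of \<open>C\<close> contain \<open>a\<close> and
  \<open>b\<close> respectively, so the bridge joins them.\<close>

lemma rel_decomposition_bridge:
  assumes d\<^sub>1: "rel_decomposition (G \<restriction> (A \<union> C)) V\<^sub>1 E\<^sub>1 X\<^sub>1"
    and d\<^sub>2: "rel_decomposition (G \<restriction> (B \<union> C)) V\<^sub>2 E\<^sub>2 X\<^sub>2"
    and cut: "cut_partition G A B C" and wf: "wf_digraph G"
    and disj: "V\<^sub>1 \<inter> V\<^sub>2 = {}"
    and a: "a \<in> V\<^sub>1" "C \<subseteq> X\<^sub>1 a" and b: "b \<in> V\<^sub>2" "C \<subseteq> X\<^sub>2 b"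
  shows "rel_decomposition G (V\<^sub>1 \<union> V\<^sub>2) (E\<^sub>1 \<union> E\<^sub>2 \<union> {(a, b), (b, a)})
    (\<lambda>t. if t \<in> V\<^sub>1 then X\<^sub>1 t else X\<^sub>2 t)"
    (is "rel_decomposition G ?V ?E ?X")
proof -
  have V: "verts G = A \<union> B \<union> C" and ABC: "A \<inter> B = {}" "A \<inter> C = {}" "B \<inter> C = {}"
    using cut by (auto simp: cut_partition_def)
  have t: "rel_tree V\<^sub>1 E\<^sub>1" "rel_tree V\<^sub>2 E\<^sub>2"
    and X: "\<And>t. t \<in> V\<^sub>1 \<Longrightarrow> X\<^sub>1 t \<subseteq> A \<union> C" "\<And>t. t \<in> V\<^sub>2 \<Longrightarrow> X\<^sub>2 t \<subseteq> B \<union> C"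
    and e\<^sub>1: "\<And>u v. u \<rightarrow>\<^bsub>G\<^esub> v \<Longrightarrow> u \<in> A \<union> C \<Longrightarrow> v \<in> A \<union> C \<Longrightarrow> \<exists>t\<in>V\<^sub>1. u \<in> X\<^sub>1 t \<and> v \<in> X\<^sub>1 t"
    and e\<^sub>2: "\<And>u v. u \<rightarrow>\<^bsub>G\<^esub> v \<Longrightarrow> u \<in> B \<union> C \<Longrightarrow> v \<in> B \<union> C \<Longrightarrow> \<exists>t\<in>V\<^sub>2. u \<in> X\<^sub>2 t \<and> v \<in> X\<^sub>2 t"
    and c\<^sub>1: "\<And>u. u \<in> A \<union> C \<Longrightarrow> rel_connected E\<^sub>1 {t \<in> V\<^sub>1. u \<in> X\<^sub>1 t}"
    and c\<^sub>2: "\<And>u. u \<in> B \<union> C \<Longrightarrow> rel_connected E\<^sub>2 {t \<in> V\<^sub>2. u \<in> X\<^sub>2 t}"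
    using d\<^sub>1 d\<^sub>2 by (simp_all add: rel_decomposition_def arcs_ends_induce_subgraph)
  have X\<^sub>2: "?X t = X\<^sub>2 t" if "t \<in> V\<^sub>2" for t using that disj by auto
  have nodes: "{t \<in> ?V. u \<in> ?X t} = {t \<in> V\<^sub>1. u \<in> X\<^sub>1 t} \<union> {t \<in> V\<^sub>2. u \<in> X\<^sub>2 t}" for u
    using disj by auto
  have mono: "rel_connected E\<^sub>1 S \<Longrightarrow> rel_connected ?E S" "rel_connected E\<^sub>2 S \<Longrightarrow> rel_connected ?E S" for S
    by (erule rel_connected_mono; blast)+
  have "rel_connected ?E {t \<in> ?V. u \<in> ?X t}" if u: "u \<in> verts G" for u
  proof -
    consider "u \<in> A" | "u \<in> B" | "u \<in> C" using V u by blast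
    then show ?thesis
    proof cases
      case 1
      then have "{t \<in> V\<^sub>2. u \<in> X\<^sub>2 t} = {}" using X(2) ABC by blast
      moreover have "rel_connected ?E {t \<in> V\<^sub>1. u \<in> X\<^sub>1 t}"
        using 1 by (intro mono(1) c\<^sub>1) simp
      ultimately show ?thesis by (simp only: nodes Un_empty_right)
    next
      case 2
      then have "{t \<in> V\<^sub>1. u \<in> X\<^sub>1 t} = {}" using X(1) ABC by blast
      moreover have "rel_connected ?E {t \<in> V\<^sub>2. u \<in> X\<^sub>2 t}"
        using 2 by (intro mono(2) c\<^sub>2) simp
      ultimately show ?thesis by (simp only: nodes Un_empty_left)
    next
      case 3
      have "rel_connected ?E {t \<in> V\<^sub>1. u \<in> X\<^sub>1 t}" "rel_connected ?E {t \<in> V\<^sub>2. u \<in> X\<^sub>2 t}"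
        using 3 mono(1)[OF c\<^sub>1[of u]] mono(2)[OF c\<^sub>2[of u]] by blast+
      then show ?thesis
        unfolding nodes by (rule rel_connected_bridge[of _ _ _ a b]) (use 3 a b in auto)
    qed
  qed
  moreover have "\<exists>t\<in>?V. u \<in> ?X t \<and> v \<in> ?X t" if uv: "u \<rightarrow>\<^bsub>G\<^esub> v" for u v
  proof -
    \<comment> \<open>No edge runs between \<open>A\<close> and \<open>B\<close>, so each edge lies
      within one side.\<close>
    have "u \<in> A \<union> C \<and> v \<in> A \<union> C \<or> u \<in> B \<union> C \<and> v \<in> B \<union> C"
      using cut uv wf_digraph.adj_in_verts[OF wf uv] unfolding cut_partition_def by blast
    then show ?thesis
    proof
      assume "u \<in> A \<union> C \<and> v \<in> A \<union> C"
      then show ?thesis using e\<^sub>1[OF uv] by auto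
    next
      assume "u \<in> B \<union> C \<and> v \<in> B \<union> C"
      then show ?thesis using e\<^sub>2[OF uv] X\<^sub>2 by (metis Un_iff)
    qed
  qed
  moreover have "?X t \<subseteq> verts G" if "t \<in> ?V" for t
    using that X[of t] V by auto
  ultimately show ?thesis
    using rel_tree_bridge[OF t disj a(1) b(1)] by (simp add: rel_decomposition_def)
qed

lemma tree_alpha_le_max_if_clique_cutset:
  assumes "fin_digraph G" "clique G C" and cut: "cut_partition G A B C"
  shows "tree_alpha G \<le> max (tree_alpha (G \<restriction> (A \<union> C))) (tree_alpha (G \<restriction> (B \<union> C)))"
    (is "_ \<le> ?k")
proof -
  interpret fin_digraph G by fact
  have AC: "A \<union> C \<subseteq> verts G" and BC: "B \<union> C \<subseteq> verts G"
    using cut by (auto simp: cut_partition_def)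
  then have "finite C" using finite_subset[OF _ finite_verts] by auto
  \<comment> \<open>Stated for an arbitrary injection \<open>f\<close>, so that the two sides can be
    renamed into disjoint ranges. Bags are measured in \<open>G\<close> instead of
    \<open>G \<restriction> S\<close>, as the joined decomposition requires.\<close>
  have half: "\<exists>(V :: nat set) E X. \<exists>t\<in>V. rel_decomposition (G \<restriction> S) V E X \<and> C \<subseteq> X t \<and>
      V \<subseteq> range f \<and> (\<forall>t\<in>V. indep_number (G \<restriction> X t) \<le> tree_alpha (G \<restriction> S))"
    if S: "S \<subseteq> verts G" "C \<subseteq> S" and f: "inj f" for S and f :: "nat \<Rightarrow> nat"
  proof -
    obtain V :: "nat set" and E X where VEX: "rel_decomposition (G \<restriction> S) V E X"
      and le: "\<And>t. t \<in> V \<Longrightarrow> indep_number ((G \<restriction> S) \<restriction> X t) \<le> tree_alpha (G \<restriction> S)"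
      using tree_alpha_le_iff[of "G \<restriction> S" "tree_alpha (G \<restriction> S)", OF wellformed_induce_subgraph]
      by blast
    have "clique (G \<restriction> S) C"
      using assms(2) S(2) by (auto simp: clique_def pairwise_def arcs_ends_induce_subgraph)
    then obtain t where t: "t \<in> V" "C \<subseteq> X t"
      using clique_subset_bag[OF VEX _ \<open>finite C\<close>] by blast
    have "indep_number (G \<restriction> X t) \<le> tree_alpha (G \<restriction> S)" if "t \<in> V" for t
      using le[OF that] VEX that by (simp add: rel_decomposition_def induce_subgraph_induce_subgraph)
    then show ?thesis
      using rel_decomposition_image[OF f VEX] t f
      by (intro exI[of _ "f ` V"] exI[of _ "map_prod f f ` E"] exI[of _ "\<lambda>t. X (inv f t)"]
          bexI[of _ "f t"]) auto
  qed
  \<comment> \<open>Even numbers serve as nodes for one side and odd numbers for the other.\<close>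
  have inj: "inj (\<lambda>n :: nat. 2 * n)" "inj (\<lambda>n :: nat. Suc (2 * n))" by (auto intro: injI)
  obtain V\<^sub>1 :: "nat set" and E\<^sub>1 X\<^sub>1 a where
    1: "a \<in> V\<^sub>1" "rel_decomposition (G \<restriction> (A \<union> C)) V\<^sub>1 E\<^sub>1 X\<^sub>1" "C \<subseteq> X\<^sub>1 a"
      "V\<^sub>1 \<subseteq> range (\<lambda>n. 2 * n)"
      "\<forall>t\<in>V\<^sub>1. indep_number (G \<restriction> X\<^sub>1 t) \<le> tree_alpha (G \<restriction> (A \<union> C))"
    using half[OF AC Un_upper2 inj(1)] by blast
  obtain V\<^sub>2 :: "nat set" and E\<^sub>2 X\<^sub>2 b where
    2: "b \<in> V\<^sub>2" "rel_decomposition (G \<restriction> (B \<union> C)) V\<^sub>2 E\<^sub>2 X\<^sub>2" "C \<subseteq> X\<^sub>2 b"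
      "V\<^sub>2 \<subseteq> range (\<lambda>n. Suc (2 * n))"
      "\<forall>t\<in>V\<^sub>2. indep_number (G \<restriction> X\<^sub>2 t) \<le> tree_alpha (G \<restriction> (B \<union> C))"
    using half[OF BC Un_upper2 inj(2)] by blast
  have "even t" if "t \<in> V\<^sub>1" for t using subsetD[OF 1(4) that] by auto
  moreover have "odd t" if "t \<in> V\<^sub>2" for t using subsetD[OF 2(4) that] by auto
  ultimately have "V\<^sub>1 \<inter> V\<^sub>2 = {}" by blast
  note rel_decomposition_bridge[OF 1(2) 2(2) cut wf_digraph this 1(1,3) 2(1,3)]
  moreover have "\<forall>t\<in>V\<^sub>1 \<union> V\<^sub>2. indep_number (G \<restriction> (if t \<in> V\<^sub>1 then X\<^sub>1 t else X\<^sub>2 t)) \<le> ?k"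
    using 1(5) 2(5) by (auto simp: le_max_iff_disj)
  ultimately show ?thesis unfolding tree_alpha_le_iff[OF wf_digraph] by blast
qed

theorem corollary3p11:
  fixes G :: "('a, 'b) pre_digraph" and A B C :: "'a set"
  assumes "graph G"
    and "clique_cutset G C"
    and "cut_partition G A B C"
  shows "tree_alpha G = max (tree_alpha (G \<restriction> (A \<union> C))) (tree_alpha (G \<restriction> (B \<union> C)))"
proof (rule antisym)
  interpret graph G by fact
  have "A \<union> C \<subseteq> verts G" "B \<union> C \<subseteq> verts G"
    using assms(3) by (auto simp: cut_partition_def)
  then show "max (tree_alpha (G \<restriction> (A \<union> C))) (tree_alpha (G \<restriction> (B \<union> C))) \<le> tree_alpha G"
    using tree_alpha_induce_subgraph_le[OF fin_digraph] by simp
  show "tree_alpha G \<le> max (tree_alpha (G \<restriction> (A \<union> C))) (tree_alpha (G \<restriction> (B \<union> C)))"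
    using assms(2,3) fin_digraph
    by (intro tree_alpha_le_max_if_clique_cutset) (auto simp: clique_cutset_def)
qed

end
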